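(* Let $p$ be a prime with $p\equiv 1\pmod 4$, let $n=\frac{p-1}{2}$, let $\zeta=e^{2\pi i/p}$, and let $\left(\frac{\cdot}{p}\right)$ denote the Legendre symbol (with $\left(\frac{0}{p}\right)=0$). Define $(n+1)\times(n+1)$ matrices, with rows and columns indexed by $0,\dots,n$: $$U_{ij}=\frac{\left(\frac{i}{p}\right)\zeta^{-j-2i}+\left(\frac{j}{p}\right)\zeta^{-2j-i}}{\zeta^{-i-j}+\left(\frac{i}{p}\right)\left(\frac{j}{p}\right)},\qquad V_{ij}=\zeta^{2ij},$$ and $D$ the diagonal matrix with $D_{ii}=\prod_{0\le k\le n,\,k\ne i}\frac{1}{\zeta^{2i}-\zeta^{2k}}$ and $D_{ij}=0$ for $i\neq j$. Let $\tau_p(r)=\sum_{k=1}^{p-1}\left(\frac{kr}{p}\right)\zeta^k$ be the Gauss sum, and let $C$ be the $(n+1)\times(n+1)$ matrix with $C_{ij}=\left(\frac{j-i}{p}\right)$, $0\le i,j\le n$. Then $$C=\tau_p(2)\,\zeta^{(p-1)/4}\,VDUDV=\left(\frac{2}{p}\right)\sqrt p\,\zeta^{(p-1)/4}\,VDUDV,$$ where $\sqrt p>0$. *)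

theory Defs
  imports Complex_Main "HOL-Number_Theory.Residues" "Jordan_Normal_Form.Matrix"
begin

definition zeta :: "nat \<Rightarrow> complex"
  where "zeta p = exp (2 * of_real pi * \<i> / of_nat p)"

definition legendre :: "nat \<Rightarrow> int \<Rightarrow> complex"
  where "legendre p a = of_int (Legendre a (int p))"

definition gauss_sum :: "nat \<Rightarrow> int \<Rightarrow> complex"
  where "gauss_sum p r = (\<Sum>k = 1..p - 1. legendre p (int k * r) * zeta p ^ k)"

text \<open>
  The denominators in \<open>matU\<close> and \<open>matD\<close> do not vanish for an odd prime \<open>p\<close>
  and indices at most \<open>(p - 1) div 2\<close>, so the convention \<open>x / 0 = 0\<close> plays no role.
\<close>

definition matU :: "nat \<Rightarrow> complex mat"
  where "matU p = (let n = (p - 1) div 2 in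
    mat (n + 1) (n + 1) (\<lambda>(i, j).
      (legendre p (int i) * zeta p powi (- int j - 2 * int i)
        + legendre p (int j) * zeta p powi (- 2 * int j - int i))
      / (zeta p powi (- int i - int j) + legendre p (int i) * legendre p (int j))))"

definition matV :: "nat \<Rightarrow> complex mat"
  where "matV p = (let n = (p - 1) div 2 in
    mat (n + 1) (n + 1) (\<lambda>(i, j). zeta p ^ (2 * i * j)))"

definition matD :: "nat \<Rightarrow> complex mat"
  where "matD p = (let n = (p - 1) div 2 in
    mat_diag (n + 1) (\<lambda>i. \<Prod>k\<in>{0..n} - {i}. 1 / (zeta p ^ (2 * i) - zeta p ^ (2 * k))))"

definition matC :: "nat \<Rightarrow> complex mat"
  where "matC p = (let n = (p - 1) div 2 in
    mat (n + 1) (n + 1) (\<lambda>(i, j). legendre p (int j - int i)))"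

end

theory Submission
  imports Defs "HOL-Number_Theory.Euler_Criterion" "Jordan_Normal_Form.Schur_Decomposition"
begin

text \<open>
  Write \<open>x\<^sub>i = \<zeta>\<^bsup>2i\<^esup>\<close>, \<open>y\<^sub>i = 1 / x\<^sub>i\<close> and \<open>\<tau> = \<tau>\<^sub>p(2)\<close>. Since \<open>\<tau>\<^sup>2 = p\<close>, the entry \<open>\<chi>(b - a)\<close> of \<open>C\<close> is
  \<open>(\<tau>/p) \<Sum>\<^sub>k \<chi>(k) x\<^sub>k\<^bsup>b-a\<^esup>\<close> over all residues \<open>k\<close>. Folding \<open>k\<close> with \<open>-k\<close> leaves the terms
  \<open>\<chi>(k) (y\<^sub>k\<^sup>a x\<^sub>k\<^sup>b + x\<^sub>k\<^sup>a y\<^sub>k\<^sup>b)\<close> with \<open>1 \<le> k \<le> n\<close>, and Lagrange interpolation at the nodes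
  \<open>x\<^sub>0, \<dots>, x\<^sub>n\<close> expresses powers of \<open>y\<^sub>k\<close> by powers of the \<open>x\<^sub>i\<close>. The resulting coefficients are those of
  \<open>DUD\<close> because, with \<open>P = \<Prod>\<^sub>i (X - x\<^sub>i)\<close>, the factorization of \<open>X\<^sup>p - 1\<close> gives
  \<open>P'(x\<^sub>j) P(y\<^sub>j) = p \<zeta>\<^bsup>n/2\<^esup> \<zeta>\<^bsup>-j\<^esup> (\<zeta>\<^bsup>-2j\<^esup> - 1)\<close>.

  The sign of the Gauss sum is determined by Schur's argument: \<open>\<tau>\<^sub>p(1)\<close> is the trace of the matrix
  \<open>F = (\<zeta>\<^bsup>ij\<^esup>)\<close> of order \<open>p\<close>, whose eigenvalues lie in \<open>{\<plusminus>\<surd>p, \<plusminus>i\<surd>p}\<close> as \<open>F\<^sup>4 = p\<^sup>2\<close>. Their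
  multiplicities follow from the traces of \<open>F\<close> and \<open>F\<^sup>2\<close> up to one sign, which is read off the
  Vandermonde determinant of \<open>F\<close>.
\<close>

section \<open>Matrices and interpolation\<close>

text \<open>Both sides are polynomials in \<open>y\<close> of degree at most \<open>n\<close> that
  agree at the \<open>n + 1\<close> distinct nodes. The inverse differences form a separate product
  because they become the diagonal entries of \<open>matD\<close>.\<close>

lemma lagrange_interpolation_power:
  fixes x :: "nat \<Rightarrow> 'a::field"
  assumes inj: "inj_on x {..n}" and a: "a \<le> n"
  shows "y ^ a = (\<Sum>i\<le>n. x i ^ a * (\<Prod>k\<in>{..n} - {i}. 1 / (x i - x k)) * (\<Prod>k\<in>{..n} - {i}. y - x k))"
proof -
  define L where "L i = (\<Prod>k\<in>{..n} - {i}. [:- x k, 1:])" for i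
  define d where "d i = (\<Prod>k\<in>{..n} - {i}. 1 / (x i - x k))" for i
  have deg_L: "degree (L i) = n" if "i \<le> n" for i
  proof -
    have "degree (L i) = (\<Sum>k\<in>{..n} - {i}. degree [:- x k, 1:])"
      unfolding L_def by (rule degree_prod_eq_sum_degree) auto
    then show ?thesis using that by simp
  qed
  have poly_L: "poly (L i) z = (\<Prod>k\<in>{..n} - {i}. z - x k)" for i z
    by (simp add: L_def poly_prod)
  have "monom 1 a = (\<Sum>i\<le>n. smult (x i ^ a * d i) (L i))"
  proof (rule poly_eqI_degree[of "x ` {..n}"])
    have card: "card (x ` {..n}) = Suc n" using inj by (simp add: card_image)
    show "degree (monom (1::'a) a) < card (x ` {..n})"
      unfolding card using a degree_monom_le[of "1::'a" a] by linarith
    have "degree (\<Sum>i\<le>n. smult (x i ^ a * d i) (L i)) \<le> n"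
      by (intro degree_sum_le) (auto intro: order_trans[OF degree_smult_le] simp: deg_L)
    then show "degree (\<Sum>i\<le>n. smult (x i ^ a * d i) (L i)) < card (x ` {..n})"
      unfolding card by simp
    fix z assume "z \<in> x ` {..n}"
    then obtain j where j: "j \<le> n" "z = x j" by auto
    have "poly (smult (x i ^ a * d i) (L i)) z = (if i = j then x j ^ a else 0)"
      if "i \<le> n" for i
    proof (cases "i = j")
      case True
      have "d j * poly (L j) (x j) = (\<Prod>k\<in>{..n} - {j}. 1 / (x j - x k) * (x j - x k))"
        unfolding d_def poly_L by (rule prod.distrib[symmetric])
      also have "\<dots> = 1"
      proof (rule prod.neutral, intro ballI)
        fix k assume "k \<in> {..n} - {j}"
        then have "x j \<noteq> x k" using inj j(1) by (auto simp: inj_on_def)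
        then show "1 / (x j - x k) * (x j - x k) = 1" by simp
      qed
      finally show ?thesis using True j by (simp add: mult.assoc)
    next
      case False
      then have "poly (L i) z = 0" unfolding poly_L j(2) using j(1) by (auto simp: prod_zero_iff)
      with False show ?thesis by simp
    qed
    then show "poly (monom 1 a) z = poly (\<Sum>i\<le>n. smult (x i ^ a * d i) (L i)) z"
      using j by (simp add: poly_sum poly_monom del: poly_smult)
  qed
  then have "poly (monom 1 a) y = poly (\<Sum>i\<le>n. smult (x i ^ a * d i) (L i)) y" by simp
  then show ?thesis by (simp add: poly_sum poly_monom poly_L d_def)
qed

text \<open>In the Newton basis the Vandermonde matrix becomes lower triangular.\<close>

lemma det_vandermonde:
  fixes x :: "nat \<Rightarrow> 'a::field"
  shows "det (mat m m (\<lambda>(i, j). x i ^ j)) = (\<Prod>i<m. \<Prod>k<i. x i - x k)"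
proof -
  define N where "N j = (\<Prod>k<j. [:- x k, 1:])" for j
  define V where "V = mat m m (\<lambda>(i, j). x i ^ j)"
  \<comment> \<open>Column \<open>j\<close> of \<open>T\<close> holds the coefficients of the monic
    polynomial \<open>N j\<close> of degree \<open>j\<close>, so \<open>T\<close> is unit upper
    triangular, and \<open>V * T\<close> tabulates the values \<open>poly (N j) (x i)\<close>, which
    vanish for \<open>i < j\<close>.\<close>
  define T where "T = mat m m (\<lambda>(k, j). coeff (N j) k)"
  have monic: "degree (N j) = j \<and> lead_coeff (N j) = 1" for j
  proof -
    have "degree (N j) = (\<Sum>k<j. degree [:- x k, 1:])"
      unfolding N_def by (rule degree_prod_eq_sum_degree) auto
    moreover have "lead_coeff (N j) = 1" unfolding N_def by (simp add: lead_coeff_prod)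
    ultimately show ?thesis by simp
  qed
  have poly_N: "poly (N j) z = (\<Prod>k<j. z - x k)" for j z
    by (simp add: N_def poly_prod)
  have VT: "V \<in> carrier_mat m m" "T \<in> carrier_mat m m" by (simp_all add: V_def T_def)
  have entry: "(V * T) $$ (i, j) = (\<Prod>k<j. x i - x k)" if "i < m" "j < m" for i j
  proof -
    have "(V * T) $$ (i, j) = (\<Sum>k<m. coeff (N j) k * x i ^ k)"
      using that by (simp add: V_def T_def scalar_prod_def atLeast0LessThan mult.commute)
    also have "\<dots> = (\<Sum>k\<le>j. coeff (N j) k * x i ^ k)"
      using that monic[of j] by (intro sum.mono_neutral_right) (auto simp: coeff_eq_0)
    also have "\<dots> = poly (N j) (x i)" using monic[of j] by (simp add: poly_altdef)
    finally show ?thesis by (simp add: poly_N)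
  qed
  have "det T = prod_list (diag_mat T)"
    using monic by (intro det_upper_triangular) (auto simp: T_def coeff_eq_0)
  also have "diag_mat T = map (\<lambda>_. 1) [0..<m]"
    unfolding diag_mat_def T_def using monic by (auto intro!: map_cong) (metis)
  also have "prod_list \<dots> = 1" by (simp add: prod.distinct_set_conv_list[symmetric])
  finally have "det T = 1" .
  moreover have "det (V * T) = det V * det T" using VT by (rule det_mult)
  ultimately have "det V = det (V * T)" by simp
  also have "\<dots> = prod_list (diag_mat (V * T))"
  proof (rule det_lower_triangular)
    show "V * T \<in> carrier_mat m m" using VT by simp
    show "(V * T) $$ (i, j) = 0" if "i < j" "j < m" for i j
      using that by (simp add: entry prod_zero_iff) auto
  qed
  also have "diag_mat (V * T) = map (\<lambda>i. \<Prod>k<i. x i - x k) [0..<m]"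
    unfolding diag_mat_def using VT by (auto intro!: map_cong simp: entry simp del: index_mult_mat(1))
  also have "prod_list \<dots> = (\<Prod>i<m. \<Prod>k<i. x i - x k)"
    by (simp add: prod.distinct_set_conv_list[symmetric] atLeast0LessThan)
  finally show ?thesis by (simp add: V_def)
qed

section \<open>Trace, similarity and triangular form\<close>

definition mat_trace :: "'a::comm_monoid_add mat \<Rightarrow> 'a" where
  "mat_trace A = (\<Sum>i<dim_row A. A $$ (i, i))"

lemma mat_trace_mult_comm:
  fixes A B :: "'a::comm_semiring_0 mat"
  assumes "A \<in> carrier_mat m m" "B \<in> carrier_mat m m"
  shows "mat_trace (A * B) = mat_trace (B * A)"
proof -
  have "mat_trace (A * B) = (\<Sum>i<m. \<Sum>j<m. A $$ (i, j) * B $$ (j, i))"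
    using assms by (simp add: mat_trace_def scalar_prod_def atLeast0LessThan)
  also have "\<dots> = (\<Sum>j<m. \<Sum>i<m. A $$ (i, j) * B $$ (j, i))" by (rule sum.swap)
  also have "\<dots> = mat_trace (B * A)"
    using assms by (simp add: mat_trace_def scalar_prod_def atLeast0LessThan mult.commute)
  finally show ?thesis .
qed

lemma mat_trace_similar:
  fixes A B :: "'a::comm_ring_1 mat"
  assumes "similar_mat A B"
  shows "mat_trace A = mat_trace B"
proof -
  obtain m P Q where *: "{A, B, P, Q} \<subseteq> carrier_mat m m" "Q * P = 1\<^sub>m m" "A = P * B * Q"
    using similar_matD[OF assms] by blast
  then have c: "B \<in> carrier_mat m m" "P \<in> carrier_mat m m" "Q \<in> carrier_mat m m" by auto
  have "mat_trace A = mat_trace (P * (B * Q))" unfolding *(3) using c by (simp add: assoc_mult_mat[of P m m B m Q m])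
  also have "\<dots> = mat_trace (B * Q * P)" using c by (intro mat_trace_mult_comm[of _ m]) auto
  also have "B * Q * P = B" using c *(2) by (simp add: assoc_mult_mat[of B m m Q m P m])
  finally show ?thesis .
qed

lemma similar_mat_square:
  fixes A B :: "'a::comm_ring_1 mat"
  assumes "similar_mat A B"
  shows "similar_mat (A * A) (B * B)"
proof -
  obtain m P Q where *: "{A, B, P, Q} \<subseteq> carrier_mat m m" "P * Q = 1\<^sub>m m" "Q * P = 1\<^sub>m m" "A = P * B * Q"
    using similar_matD[OF assms] by blast
  then have c: "B \<in> carrier_mat m m" "P \<in> carrier_mat m m" "Q \<in> carrier_mat m m" by auto
  note assoc = assoc_mult_mat[of _ m m _ m _ m]
  have "Q * (P * (B * Q)) = (Q * P) * (B * Q)" using c by (simp add: assoc)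
  also have "\<dots> = B * Q" unfolding *(3) using c by simp
  finally have "A * A = P * (B * B) * Q" unfolding *(4) using c by (simp add: assoc)
  moreover have "{A * A, B * B, P, Q} \<subseteq> carrier_mat m m" using *(1) by auto
  ultimately show ?thesis using *(2,3) by (intro similar_matI[of _ _ P Q m])
qed

lemma upper_triangular_square:
  fixes B :: "'a::comm_ring_1 mat"
  assumes B: "B \<in> carrier_mat m m" and ut: "upper_triangular B"
  shows "upper_triangular (B * B)" and "i < m \<Longrightarrow> (B * B) $$ (i, i) = (B $$ (i, i))\<^sup>2"
proof -
  have zero: "B $$ (i, j) = 0" if "j < i" "i < m" for i j
    using ut that B by (auto simp: upper_triangular_def)
  have entry: "(B * B) $$ (i, j) = (\<Sum>k<m. B $$ (i, k) * B $$ (k, j))" if "i < m" "j < m" for i j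
    using that B by (simp add: scalar_prod_def atLeast0LessThan)
  show "upper_triangular (B * B)"
  proof (rule upper_triangularI)
    fix i j assume *: "j < i" "i < dim_row (B * B)"
    then have im: "i < m" "j < m" using B by auto
    have "B $$ (i, k) * B $$ (k, j) = 0" if "k < m" for k
      using zero[of k i] zero[of j k] that im * by (cases "k < i") auto
    then show "(B * B) $$ (i, j) = 0" using im by (simp add: entry)
  qed
  assume i: "i < m"
  have "(B * B) $$ (i, i) = (\<Sum>k<m. if k = i then B $$ (i, i) * B $$ (i, i) else 0)"
    unfolding entry[OF i i] using zero i
    by (intro sum.cong refl) (metis lessThan_iff linorder_neqE_nat mult_zero_left mult_zero_right)
  then show "(B * B) $$ (i, i) = (B $$ (i, i))\<^sup>2" using i by (simp add: power2_eq_square)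
qed

text \<open>The \<open>l i\<close> are the diagonal entries of a Schur form \<open>B\<close> of
  \<open>A\<close>. Trace and determinant are similarity invariants, and squaring a triangular
  matrix squares its diagonal. A scalar matrix is similar only to itself, so the last clause reads
  the fourth power of \<open>B\<close> off its diagonal.\<close>

lemma triangular_spectrum:
  fixes A :: "complex mat"
  assumes A: "A \<in> carrier_mat m m"
  obtains l :: "nat \<Rightarrow> complex" where
    "mat_trace A = (\<Sum>i<m. l i)" "mat_trace (A * A) = (\<Sum>i<m. (l i)\<^sup>2)" "det A = (\<Prod>i<m. l i)"
    "\<And>c i. A * A * (A * A) = c \<cdot>\<^sub>m 1\<^sub>m m \<Longrightarrow> i < m \<Longrightarrow> l i ^ 4 = c"
proof -
  obtain es where "char_poly A = (\<Prod>a\<leftarrow>es. [:- a, 1:])"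
    using char_poly_factorized[OF A] by blast
  then obtain B where B: "B \<in> carrier_mat m m" "upper_triangular B" and sim: "similar_mat A B"
    using schur_decomposition_exists[OF A] by blast
  define l where "l i = B $$ (i, i)" for i
  note BB = upper_triangular_square[OF B]
  have BBc: "B * B \<in> carrier_mat m m" using B by simp
  note BBBB = upper_triangular_square[OF BBc BB(1)]
  show thesis
  proof (rule that[of l])
    show "mat_trace A = (\<Sum>i<m. l i)"
      using B unfolding mat_trace_similar[OF sim] by (simp add: mat_trace_def l_def)
    show "mat_trace (A * A) = (\<Sum>i<m. (l i)\<^sup>2)"
      using B BB(2) unfolding mat_trace_similar[OF similar_mat_square[OF sim]]
      by (simp add: mat_trace_def l_def del: index_mult_mat(1)) 
    have "det A = prod_list (diag_mat B)"
      unfolding det_similar[OF sim] by (rule det_upper_triangular[OF B(2,1)])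
    then show "det A = (\<Prod>i<m. l i)"
      using B by (simp add: diag_mat_def l_def prod.distinct_set_conv_list[symmetric] atLeast0LessThan)
    fix c i assume c: "A * A * (A * A) = c \<cdot>\<^sub>m 1\<^sub>m m" and i: "i < m"
    have "similar_mat (c \<cdot>\<^sub>m 1\<^sub>m m) (B * B * (B * B))"
      using similar_mat_square[OF similar_mat_square[OF sim]] unfolding c .
    from similar_matD[OF similar_mat_sym[OF this]] obtain m' P Q
      where *: "{c \<cdot>\<^sub>m 1\<^sub>m m, B * B * (B * B), P, Q} \<subseteq> carrier_mat m' m'"
      "P * Q = 1\<^sub>m m'" "B * B * (B * B) = P * (c \<cdot>\<^sub>m 1\<^sub>m m) * Q"
      by blast
    have m': "m' = m" using *(1) by auto
    have PQ: "P \<in> carrier_mat m m" "Q \<in> carrier_mat m m" using *(1) m' by auto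
    have "P * (c \<cdot>\<^sub>m 1\<^sub>m m) * Q = c \<cdot>\<^sub>m (P * Q)"
      using PQ by (simp add: mult_smult_distrib[of _ m m _ m] mult_smult_assoc_mat[of _ m m _ m])
    then have "B * B * (B * B) = c \<cdot>\<^sub>m 1\<^sub>m m" using *(2,3) m' by simp
    then have "(B * B * (B * B)) $$ (i, i) = c" using i by (simp del: index_mult_mat(1))
    moreover have "(B * B * (B * B)) $$ (i, i) = l i ^ 4"
      using BBBB(2)[OF i] BB(2)[OF i] by (simp add: l_def)
    ultimately show "l i ^ 4 = c" by simp
  qed
qed

section \<open>Identities for Schur's eigenvalue and determinant argument\<close>

lemma prod_cis: "(\<Prod>i\<in>A. cis (f i)) = cis (\<Sum>i\<in>A. f i)"
  by (induction A rule: infinite_finite_induct) (simp_all add: cis_mult)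

text \<open>Extracting the phase of the midpoint leaves \<i> times a real number whose sign is that
  of a sine.\<close>

lemma cis_diff_cis: "cis a - cis b = cis ((a + b) / 2) * (\<i> * complex_of_real (2 * sin ((a - b) / 2)))"
proof -
  define u v where "u = (a + b) / 2" and "v = (a - b) / 2"
  have "cis a - cis b = cis u * (cis v - cis (- v))"
    by (simp add: u_def v_def cis_mult right_diff_distrib) (simp add: field_simps)
  also have "cis v - cis (- v) = \<i> * complex_of_real (2 * sin v)"
    by (simp add: complex_eq_iff)
  finally show ?thesis by (simp add: u_def v_def)
qed

text \<open>Twice the sum of all \<open>i + k\<close> with \<open>k < i < m\<close>; up to scaling,
  these terms are the midpoint phases of the factors of the Vandermonde determinant.\<close>

lemma sum_sum_add: "2 * (\<Sum>i<m. \<Sum>k<i. real i + real k) = real m * (real m - 1)\<^sup>2"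
proof -
  have inner: "2 * (\<Sum>k<i. real i + real k) = 3 * (real i)\<^sup>2 - real i" for i
  proof -
    have "2 * (\<Sum>k<i. real k) = real i * (real i - 1)"
      by (induction i) (simp_all add: algebra_simps)
    then show ?thesis by (simp add: sum.distrib power2_eq_square algebra_simps)
  qed
  show ?thesis
  proof (induction m)
    case (Suc m)
    have "2 * (\<Sum>i<Suc m. \<Sum>k<i. real i + real k) = real m * (real m - 1)\<^sup>2 + (3 * (real m)\<^sup>2 - real m)"
      unfolding sum.lessThan_Suc distrib_left Suc.IH inner ..
    then show ?case by (simp add: power2_eq_square algebra_simps)
  qed simp
qed

lemma fourth_root_of_unity:
  fixes z :: complex
  assumes "z ^ 4 = 1"
  shows "z \<in> {1, - 1, \<i>, - \<i>}"
proof -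
  have "(z - 1) * (z + 1) * ((z - \<i>) * (z + \<i>)) = z ^ 4 - 1"
    by (simp add: power4_eq_xxxx algebra_simps)
  then show ?thesis using assms by (auto simp: eq_neg_iff_add_eq_0)
qed

section \<open>Roots of unity and the quadratic character\<close>

locale prime_1_mod_4 =
  fixes p n :: nat
  assumes prime_p: "prime p" and cong_p: "[p = 1] (mod 4)"
  defines "n \<equiv> (p - 1) div 2"
begin

lemma p_gt_2: "p > 2" and even_n: "even n" and p_eq: "p = 2 * n + 1"
proof -
  have "p mod 4 = 1" using cong_p by (simp add: cong_def)
  moreover have "p \<ge> 2" using prime_p by (rule prime_ge_2_nat)
  ultimately show "p > 2" "even n" "p = 2 * n + 1" unfolding n_def by presburger+
qed

lemma int_p_eq: "int p = 2 * int n + 1"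
  using p_eq by simp

text \<open>The standard additive character modulo \<open>p\<close>; integer arguments allow
  negative exponents and congruences.\<close>

definition e :: "int \<Rightarrow> complex"
  where "e k = zeta p powi k"

lemma e_cis: "e k = cis (2 * pi * of_int k / of_nat p)"
proof -
  have "zeta p = cis (2 * pi / of_nat p)"
    unfolding zeta_def cis_conv_exp by (simp add: field_simps)
  then show ?thesis
    unfolding e_def by (simp add: cis_power_int field_simps)
qed

lemma e_0 [simp]: "e 0 = 1" and e_add: "e (a + b) = e a * e b"
  and e_nonzero [simp]: "e a \<noteq> 0" and e_power: "e a ^ k = e (a * int k)"
  by (simp_all add: e_cis cis_mult DeMoivre add_divide_distrib algebra_simps)

lemma e_minus: "e (- a) = inverse (e a)"
  by (simp add: e_def power_int_minus)

lemma e_diff: "e (a - b) = e a / e b"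
  using e_add[of a "- b"] by (simp add: e_minus field_simps)

lemma e_eq_1_iff: "e k = 1 \<longleftrightarrow> int p dvd k"
proof -
  have p0: "real p > 0" using p_gt_2 by simp
  \<comment> \<open>On the unit circle, real part 1 forces imaginary part 0, so the cosine alone
    decides.\<close>
  have "e k = 1 \<longleftrightarrow> cos (2 * pi * of_int k / of_nat p) = 1"
    unfolding e_cis
    by (auto simp: complex_eq_iff) (metis cos_one_sin_zero)
  also have "\<dots> \<longleftrightarrow> (\<exists>m::int. 2 * pi * of_int k / of_nat p = of_int m * 2 * pi)"
    by (rule cos_one_2pi_int)
  also have "\<dots> \<longleftrightarrow> (\<exists>m::int. of_int k = (of_int (int p * m) :: real))"
    using p0 by (intro ex_cong1) (auto simp: field_simps)
  also have "\<dots> \<longleftrightarrow> int p dvd k"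
    unfolding of_int_eq_iff by (auto simp: dvd_def)
  finally show ?thesis .
qed

lemma e_eq_iff: "e a = e b \<longleftrightarrow> [a = b] (mod int p)"
proof -
  have "e a = e b \<longleftrightarrow> e (a - b) = 1" by (simp add: e_diff)
  then show ?thesis by (simp add: e_eq_1_iff cong_iff_dvd_diff)
qed

lemma e_mod: "e (k mod int p) = e k"
  by (simp add: e_eq_iff)

lemma e_p_mult: "e (int p * k) = 1" "e (k * int p) = 1"
  by (simp_all add: e_eq_1_iff)

section \<open>Sums over a complete residue system\<close>

lemma sum_residues_mult:
  fixes f :: "int \<Rightarrow> complex"
  assumes "\<And>k. f (k mod int p) = f k" and "\<not> int p dvd a"
  shows "(\<Sum>k\<in>{0..<int p}. f (a * k)) = (\<Sum>k\<in>{0..<int p}. f k)"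
proof -
  let ?A = "{0..<int p}" and ?g = "\<lambda>k. a * k mod int p"
  have cop: "coprime a (int p)"
    using assms(2) prime_p prime_imp_coprime[of "int p" a] by (simp add: coprime_commute)
  have inj: "inj_on ?g ?A"
  proof (rule inj_onI)
    fix x y assume *: "x \<in> ?A" "y \<in> ?A" "?g x = ?g y"
    then have "[a * x = a * y] (mod int p)" by (simp add: cong_def)
    then have "[x = y] (mod int p)" using cop by (simp add: cong_mult_lcancel)
    with * show "x = y" by (simp add: cong_def)
  qed
  have "?g ` ?A \<subseteq> ?A" using p_gt_2 by auto
  then have "bij_betw ?g ?A ?A"
    using inj by (simp add: bij_betw_def endo_inj_surj)
  from sum.reindex_bij_betw[OF this, of f] show ?thesis by (simp add: assms(1))
qed

text \<open>As \<open>p = 2 * n + 1\<close>, the residues above \<open>n\<close> are the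
  \<open>p - k\<close> with \<open>1 \<le> k \<le> n\<close>, and periodicity replaces
  \<open>p - k\<close> by \<open>- k\<close>.\<close>

lemma sum_residues_centered:
  fixes f :: "int \<Rightarrow> complex"
  assumes "\<And>k. f (k mod int p) = f k"
  shows "(\<Sum>k\<in>{0..<int p}. f k) = f 0 + (\<Sum>k=1..n. f (int k) + f (- int k))"
proof -
  have "{0..<int p} = {0} \<union> int ` {1..n} \<union> (\<lambda>k. int p - int k) ` {1..n}"
  proof -
    have *: "k \<in> int ` {1..n}" if "0 < k" "k \<le> int n" for k
      using that by (intro image_eqI[of _ _ "nat k"]) auto
    have **: "k \<in> (\<lambda>k. int p - int k) ` {1..n}" if "int n < k" "k < int p" for k
      using that int_p_eq by (intro image_eqI[of _ _ "nat (int p - k)"]) auto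
    have "{0..<int p} \<subseteq> {0} \<union> int ` {1..n} \<union> (\<lambda>k. int p - int k) ` {1..n}"
    proof (intro subsetI)
      fix k assume "k \<in> {0..<int p}"
      then consider "k = 0" | "0 < k" "k \<le> int n" | "int n < k" "k < int p" by force
      then show "k \<in> {0} \<union> int ` {1..n} \<union> (\<lambda>k. int p - int k) ` {1..n}"
        by cases (use * ** in blast)+
    qed
    moreover have "{0} \<union> int ` {1..n} \<union> (\<lambda>k. int p - int k) ` {1..n} \<subseteq> {0..<int p}"
      using int_p_eq by auto
    ultimately show ?thesis by (rule subset_antisym)
  qed
  moreover have "int ` {1..n} \<inter> (\<lambda>k. int p - int k) ` {1..n} = {}"
    using int_p_eq by auto
  moreover have "0 \<notin> int ` {1..n} \<union> (\<lambda>k. int p - int k) ` {1..n}"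
    using int_p_eq by auto
  ultimately have "(\<Sum>k\<in>{0..<int p}. f k)
      = f 0 + ((\<Sum>k\<in>int ` {1..n}. f k) + (\<Sum>k\<in>(\<lambda>k. int p - int k) ` {1..n}. f k))"
    by (simp add: sum.union_disjoint Un_assoc)
  also have "(\<Sum>k\<in>int ` {1..n}. f k) = (\<Sum>k=1..n. f (int k))"
    by (subst sum.reindex) auto
  also have "(\<Sum>k\<in>(\<lambda>k. int p - int k) ` {1..n}. f k) = (\<Sum>k=1..n. f (int p - int k))"
    by (subst sum.reindex) (auto simp: inj_on_def)
  also have "\<dots> = (\<Sum>k=1..n. f (- int k))"
  proof (rule sum.cong[OF refl])
    fix k
    have "f (int p - int k) = f ((int p - int k) mod int p)" by (simp only: assms)
    also have "(int p - int k) mod int p = (- int k) mod int p"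
      by (metis add.commute diff_conv_add_uminus mod_add_self2)
    finally show "f (int p - int k) = f (- int k)" by (simp only: assms)
  qed
  finally show ?thesis by (simp add: sum.distrib)
qed

lemma sum_e: "(\<Sum>k\<in>{0..<int p}. e (k * m)) = (if int p dvd m then of_nat p else 0)"
proof (cases "int p dvd m")
  case True
  then have "e (k * m) = 1" for k by (simp add: e_eq_1_iff)
  with True show ?thesis by simp
next
  case False
  have "(\<Sum>k\<in>{0..<int p}. e (k * m)) = (\<Sum>k<p. e m ^ k)"
    unfolding e_power
    by (rule sum.reindex_bij_witness[of _ int nat]) (auto simp: mult.commute)
  also have "\<dots> = (1 - e m ^ p) / (1 - e m)"
    using False e_eq_1_iff[of m] by (subst sum_gp_strict) auto
  finally show ?thesis using False by (simp add: e_power e_p_mult)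
qed

section \<open>The quadratic character\<close>

abbreviation chi :: "int \<Rightarrow> complex" where "chi \<equiv> legendre p"

lemma chi_cong: "[a = b] (mod int p) \<Longrightarrow> chi a = chi b"
proof -
  assume ab: "[a = b] (mod int p)"
  then have "QuadRes (int p) a = QuadRes (int p) b"
    unfolding QuadRes_def by (meson cong_sym cong_trans)
  moreover have "[a = 0] (mod int p) \<longleftrightarrow> [b = 0] (mod int p)"
    using ab by (meson cong_sym cong_trans)
  ultimately show ?thesis by (simp add: legendre_def Legendre_def)
qed

lemma chi_mod: "chi (a mod int p) = chi a"
  by (rule chi_cong) simp

lemma chi_0 [simp]: "chi 0 = 0"
  by (simp add: legendre_def Legendre_def)

lemma chi_sq: "\<not> int p dvd a \<Longrightarrow> chi a * chi a = 1"
  by (simp add: legendre_def Legendre_def cong_0_iff)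

lemma chi_eq_0: "int p dvd a \<Longrightarrow> chi a = 0"
  by (simp add: legendre_def Legendre_def cong_0_iff)

text \<open>Two such values differ by at most 2, which is less than \<open>p\<close>. This turns the
  congruences of Euler's criterion into equations.\<close>

lemma Legendre_eqI:
  assumes "[a = b] (mod int p)" "a \<in> {-1, 0, 1}" "b \<in> {-1, 0, 1}"
  shows "a = b"
proof -
  have "int p dvd a - b" using assms(1) by (simp add: cong_iff_dvd_diff)
  moreover have "\<bar>a - b\<bar> < int p" using assms(2,3) p_gt_2 by auto
  ultimately show ?thesis using zdvd_imp_le[of "int p" "\<bar>a - b\<bar>"] by fastforce
qed

lemma euler: "[Legendre a (int p) = a ^ n] (mod int p)"
  using euler_criterion[OF prime_p, of a] p_gt_2 by (simp add: n_def)

lemma Legendre_range: "Legendre a (int p) \<in> {-1, 0, 1}"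
  by (auto simp: Legendre_def)

lemma chi_mult: "chi (a * b) = chi a * chi b"
proof -
  have "[Legendre (a * b) (int p) = a ^ n * b ^ n] (mod int p)"
    using euler[of "a * b"] by (simp add: power_mult_distrib)
  moreover have "[Legendre a (int p) * Legendre b (int p) = a ^ n * b ^ n] (mod int p)"
    by (intro cong_mult euler)
  ultimately have "[Legendre (a * b) (int p) = Legendre a (int p) * Legendre b (int p)] (mod int p)"
    by (meson cong_sym cong_trans)
  then have "Legendre (a * b) (int p) = Legendre a (int p) * Legendre b (int p)"
    by (rule Legendre_eqI) (use Legendre_range[of "a * b"] Legendre_range[of a] Legendre_range[of b] in auto)
  then show ?thesis by (simp add: legendre_def)
qed

text \<open>Here \<open>p \<equiv> 1\<close> modulo 4 enters: \<open>n\<close> is even, so Euler's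
  criterion makes -1 a quadratic residue.\<close>

lemma chi_minus [simp]: "chi (- a) = chi a"
proof -
  have "Legendre (- 1) (int p) = 1"
    by (rule Legendre_eqI) (use Legendre_range euler[of "-1"] even_n in auto)
  then show ?thesis using chi_mult[of "-1" a] by (simp add: legendre_def)
qed

lemma card_sqrt:
  assumes "k \<in> {0..<int p}"
  shows "of_nat (card {x \<in> {0..<int p}. x\<^sup>2 mod int p = k}) = 1 + chi k"
proof (cases "QuadRes (int p) k")
  case False
  have "k mod int p = k" using assms by simp
  then have no: "x\<^sup>2 mod int p \<noteq> k" for x
    using False unfolding QuadRes_def cong_def by metis
  moreover have "k \<noteq> 0" using no[of 0] by auto
  ultimately show ?thesis
    using False assms by (auto simp: legendre_def Legendre_def cong_def)
next
  case True
  then obtain y where y: "[y\<^sup>2 = k] (mod int p)" unfolding QuadRes_def by blast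
  have pp: "prime (int p)" using prime_p by simp
  have *: "x\<^sup>2 mod int p = k \<longleftrightarrow> [x = y] (mod int p) \<or> [x = - y] (mod int p)" for x
  proof -
    have "x\<^sup>2 mod int p = k \<longleftrightarrow> [x\<^sup>2 = y\<^sup>2] (mod int p)"
      using y assms by (simp add: cong_def)
    also have "\<dots> \<longleftrightarrow> int p dvd (x - y) * (x + y)"
      by (simp add: cong_iff_dvd_diff power2_eq_square algebra_simps)
    also have "\<dots> \<longleftrightarrow> int p dvd x - y \<or> int p dvd x + y"
      using pp by (rule prime_dvd_mult_iff)
    finally show ?thesis by (simp add: cong_iff_dvd_diff)
  qed
  have eq: "{x \<in> {0..<int p}. x\<^sup>2 mod int p = k} = {y mod int p, (- y) mod int p}"
    unfolding * using p_gt_2 by (auto simp: cong_def)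
  show ?thesis
  proof (cases "k = 0")
    case True
    then have "int p dvd y\<^sup>2" using y by (simp add: cong_0_iff)
    then have "int p dvd y" using pp prime_dvd_power by blast
    then show ?thesis unfolding eq using True by (simp add: mod_eq_0_iff_dvd)
  next
    case False
    have "\<not> int p dvd y"
    proof
      assume "int p dvd y"
      then have "int p dvd y\<^sup>2" by (simp add: power2_eq_square)
      then have "k mod int p = 0" using y by (simp add: cong_def mod_eq_0_iff_dvd)
      then show False using False assms by simp
    qed
    \<comment> \<open>The square roots of \<open>k\<close> are the classes of \<open>y\<close> and
      \<open>- y\<close>; they are distinct because \<open>p\<close> is odd and does not divide
      \<open>y\<close>.\<close>
    then have "\<not> int p dvd 2 * y"
      using pp p_gt_2 by (auto simp: prime_dvd_mult_iff dest: zdvd_imp_le)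
    then have "y mod int p \<noteq> (- y) mod int p"
      by (simp add: mod_eq_dvd_iff)
    moreover have "chi k = 1"
      using True False assms by (simp add: legendre_def Legendre_def cong_def)
    ultimately show ?thesis unfolding eq by simp
  qed
qed

text \<open>Grouping the residues by their squares gives each \<open>k\<close> the weight from
  \<open>card_sqrt\<close>. With \<open>f = e\<close> this links the trace of \<open>dft\<close> to
  the Gauss sum.\<close>

lemma sum_squares:
  fixes f :: "int \<Rightarrow> complex"
  assumes "\<And>k. f (k mod int p) = f k"
  shows "(\<Sum>x\<in>{0..<int p}. f (x\<^sup>2)) = (\<Sum>k\<in>{0..<int p}. (1 + chi k) * f k)"
proof -
  have "(\<Sum>x\<in>{0..<int p}. f (x\<^sup>2)) = (\<Sum>x\<in>{0..<int p}. f (x\<^sup>2 mod int p))"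
    by (simp add: assms)
  also have "\<dots> = (\<Sum>k\<in>{0..<int p}. \<Sum>x | x \<in> {0..<int p} \<and> x\<^sup>2 mod int p = k. f (x\<^sup>2 mod int p))"
    by (rule sum.group[symmetric]) (use p_gt_2 in auto)
  also have "\<dots> = (\<Sum>k\<in>{0..<int p}. of_nat (card {x \<in> {0..<int p}. x\<^sup>2 mod int p = k}) * f k)"
    by (intro sum.cong refl) simp
  also have "\<dots> = (\<Sum>k\<in>{0..<int p}. (1 + chi k) * f k)"
    by (intro sum.cong refl) (simp only: card_sqrt)
  finally show ?thesis .
qed

text \<open>For constant \<open>f = 1\<close>, \<open>sum_squares\<close> counts the
  \<open>p\<close> residues on both sides.\<close>

lemma sum_chi: "(\<Sum>k\<in>{0..<int p}. chi k) = 0"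
  using sum_squares[of "\<lambda>_. 1"] by (simp add: sum.distrib)

section \<open>Gauss sums up to sign\<close>

lemma gauss_sum_eq: "gauss_sum p r = (\<Sum>k\<in>{0..<int p}. chi (k * r) * e k)"
proof -
  have "gauss_sum p r = (\<Sum>k\<in>{1..<int p}. chi (k * r) * e k)"
    unfolding gauss_sum_def e_def
    by (rule sum.reindex_bij_witness[of _ nat int]) auto
  also have "\<dots> = (\<Sum>k\<in>{0..<int p}. chi (k * r) * e k)"
    by (rule sum.mono_neutral_left) (auto simp: not_le int_one_le_iff_zero_less)
  finally show ?thesis .
qed

lemma gauss_sum_mult: "gauss_sum p r = chi r * gauss_sum p 1"
  unfolding gauss_sum_eq sum_distrib_left by (intro sum.cong refl) (simp add: chi_mult)

text \<open>For \<open>m\<close> prime to \<open>p\<close>, substitute \<open>m * k\<close> for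
  \<open>k\<close> in the Gauss sum and use \<open>chi m * chi m = 1\<close>. If \<open>p\<close>
  divides \<open>m\<close>, both sides vanish by \<open>sum_chi\<close>.\<close>

lemma sum_chi_e: "(\<Sum>k\<in>{0..<int p}. chi k * e (k * m)) = chi m * gauss_sum p 1"
proof (cases "int p dvd m")
  case True
  then have "e (k * m) = 1" for k by (simp add: e_eq_1_iff)
  then show ?thesis using True sum_chi by (simp add: chi_eq_0)
next
  case False
  let ?f = "\<lambda>k. chi k * e k"
  have "gauss_sum p 1 = (\<Sum>k\<in>{0..<int p}. ?f (m * k))"
    unfolding gauss_sum_eq using False
    by (subst sum_residues_mult) (simp_all add: chi_mod e_mod)
  then have "chi m * gauss_sum p 1 = (\<Sum>k\<in>{0..<int p}. (chi m * chi m) * chi k * e (k * m))"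
    by (simp add: sum_distrib_left chi_mult mult_ac)
  then show ?thesis using False by (simp add: chi_sq)
qed

lemma sum_chi_sq: "(\<Sum>k\<in>{0..<int p}. chi k * chi k) = of_nat (p - 1)"
proof -
  have "(\<Sum>k\<in>{0..<int p}. chi k * chi k) = (\<Sum>k\<in>{1..<int p}. chi k * chi k)"
    by (rule sum.mono_neutral_right) (auto simp: not_le int_one_le_iff_zero_less)
  also have "\<dots> = (\<Sum>k\<in>{1..<int p}. 1)"
    by (intro sum.cong refl chi_sq) (auto dest: zdvd_imp_le)
  finally show ?thesis by (simp add: nat_diff_distrib)
qed

text \<open>The sum of \<open>(chi m * gauss_sum p 1)\<^sup>2\<close> over all residues
  \<open>m\<close> is computed twice: directly, and by expanding with \<open>sum_chi_e\<close>,
  where orthogonality in \<open>m\<close> leaves only the pairs with \<open>l = - k\<close> modulo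
  \<open>p\<close>. Evenness of \<open>chi\<close> gives the positive sign.\<close>

lemma gauss_sum_sq: "gauss_sum p 1 * gauss_sum p 1 = of_nat p"
proof -
  let ?R = "{0..<int p}" and ?g = "gauss_sum p 1"
  have "of_nat (p - 1) * (?g * ?g) = (\<Sum>m\<in>?R. (chi m * ?g) * (chi m * ?g))"
    unfolding sum_chi_sq[symmetric] sum_distrib_right by (simp add: mult_ac)
  also have "\<dots> = (\<Sum>m\<in>?R. \<Sum>k\<in>?R. \<Sum>l\<in>?R. chi k * chi l * e (m * (k + l)))"
    unfolding sum_chi_e[symmetric] sum_product
    by (intro sum.cong refl) (simp add: ring_distribs e_add mult_ac)
  also have "\<dots> = (\<Sum>k\<in>?R. \<Sum>m\<in>?R. \<Sum>l\<in>?R. chi k * chi l * e (m * (k + l)))"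
    by (rule sum.swap)
  also have "\<dots> = (\<Sum>k\<in>?R. \<Sum>l\<in>?R. \<Sum>m\<in>?R. chi k * chi l * e (m * (k + l)))"
    by (rule sum.cong[OF refl]) (rule sum.swap)
  also have "\<dots> = (\<Sum>k\<in>?R. \<Sum>l\<in>?R. if l = (- k) mod int p then chi k * chi l * of_nat p else 0)"
  proof (intro sum.cong refl)
    fix k l assume "k \<in> ?R" "l \<in> ?R"
    then have "int p dvd k + l \<longleftrightarrow> l = (- k) mod int p"
      by (metis add.commute atLeastLessThan_iff diff_minus_eq_add mod_eq_dvd_iff mod_pos_pos_trivial)
    then show "(\<Sum>m\<in>?R. chi k * chi l * e (m * (k + l)))
        = (if l = (- k) mod int p then chi k * chi l * of_nat p else 0)"
      by (simp add: sum_distrib_left[symmetric] sum_e)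
  qed
  also have "\<dots> = (\<Sum>k\<in>?R. chi k * chi k * of_nat p)"
    using p_gt_2 by (intro sum.cong refl) (simp add: sum.delta chi_mod)
  also have "\<dots> = of_nat (p - 1) * of_nat p"
    by (simp add: sum_distrib_right[symmetric] sum_chi_sq)
  finally show ?thesis using p_gt_2 by simp
qed

section \<open>The factorization\<close>

definition x :: "nat \<Rightarrow> complex" where "x i = e (2 * int i)"
definition y :: "nat \<Rightarrow> complex" where "y i = e (- 2 * int i)"
definition d :: "nat \<Rightarrow> complex" where "d i = (\<Prod>k\<in>{..n} - {i}. 1 / (x i - x k))"
definition u :: "nat \<Rightarrow> nat \<Rightarrow> complex" where
  "u i j = (chi (int i) * e (- int j - 2 * int i) + chi (int j) * e (- 2 * int j - int i))
      / (e (- int i - int j) + chi (int i) * chi (int j))"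

lemma two_mult_cong: "[2 * a = 2 * b] (mod int p) \<longleftrightarrow> [a = b] (mod int p)"
  by (rule cong_mult_lcancel) (use int_p_eq in \<open>simp add: coprime_commute\<close>)

lemma e_two_eq_iff: "e (2 * a) = e (2 * b) \<longleftrightarrow> [a = b] (mod int p)"
  by (simp add: e_eq_iff two_mult_cong)

lemma cong_small:
  assumes "[a = b] (mod int p)" "\<bar>a - b\<bar> < int p"
  shows "a = b"
proof -
  have "int p dvd \<bar>a - b\<bar>" using assms(1) by (simp add: cong_iff_dvd_diff)
  with assms(2) show ?thesis using zdvd_imp_le[of "int p" "\<bar>a - b\<bar>"] by fastforce
qed

lemma inj_e_two: "inj_on (\<lambda>k. e (2 * k)) {- int n..int n}"
  using int_p_eq by (intro inj_onI cong_small) (auto simp: e_two_eq_iff)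

lemma inj_x: "inj_on x {..n}"
proof (rule inj_onI)
  fix i j assume "i \<in> {..n}" "j \<in> {..n}" "x i = x j"
  then show "i = j" using inj_onD[OF inj_e_two, of "int i" "int j"] by (simp add: x_def)
qed

text \<open>Doubling is injective modulo the odd \<open>p\<close>, so these are all the
  \<open>p\<close>-th roots of unity. The centred range splits them into the nodes
  \<open>x k\<close> with \<open>0 \<le> k \<le> n\<close> and the inverses \<open>y k\<close> with
  \<open>1 \<le> k \<le> n\<close>.\<close>

lemma prod_roots: "(\<Prod>k\<in>{- int n..int n}. [:- e (2 * k), 1:]) = monom 1 p - 1"
proof (rule poly_eqI_degree_lead_coeff[where n = p and A = "(\<lambda>k. e (2 * k)) ` {- int n..int n}"])
  let ?P = "\<Prod>k\<in>{- int n..int n}. [:- e (2 * k), 1:]"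
  have card: "card {- int n..int n} = p" using p_eq by simp
  have "degree ?P = (\<Sum>k\<in>{- int n..int n}. degree [:- e (2 * k), 1:])"
    by (rule degree_prod_eq_sum_degree) auto
  then have deg: "degree ?P = p" using card by simp
  then show "degree ?P \<le> p" by simp
  have "lead_coeff ?P = 1" by (simp add: lead_coeff_prod)
  then show "coeff ?P p = coeff (monom 1 p - 1) p"
    using deg p_gt_2 by simp
  show "degree (monom 1 p - 1 :: complex poly) \<le> p"
    by (intro degree_diff_le degree_monom_le) simp
  show "p \<le> card ((\<lambda>k. e (2 * k)) ` {- int n..int n})"
    using card by (simp add: card_image inj_e_two)
  fix z assume "z \<in> (\<lambda>k. e (2 * k)) ` {- int n..int n}"
  then obtain k where k: "k \<in> {- int n..int n}" "z = e (2 * k)" by auto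
  then have "poly ?P z = 0" by (auto simp: poly_prod prod_zero_iff)
  moreover have "z ^ p = 1" using k by (simp add: e_power e_p_mult)
  ultimately show "poly ?P z = poly (monom 1 p - 1) z" by (simp add: poly_monom)
qed

text \<open>The product is the derivative of \<open>X^p - 1\<close> at its root
  \<open>z = e (2 * j)\<close>, namely \<open>p * z ^ (p - 1) = p / z\<close>.\<close>

lemma prod_root_differences:
  assumes "j \<in> {- int n..int n}"
  shows "(\<Prod>k\<in>{- int n..int n} - {j}. e (2 * j) - e (2 * k)) = of_nat p * e (- 2 * j)"
proof -
  let ?R = "\<Prod>k\<in>{- int n..int n} - {j}. [:- e (2 * k), 1:]"
  have "[:- e (2 * j), 1:] * ?R = monom 1 p - 1"
    using assms by (simp add: prod_roots[symmetric] prod.remove)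
  then have "poly (pderiv ([:- e (2 * j), 1:] * ?R)) (e (2 * j)) = poly (pderiv (monom 1 p - 1)) (e (2 * j))"
    by simp
  then have "poly ?R (e (2 * j)) = of_nat p * e (2 * j) ^ (p - 1)"
    by (simp add: pderiv_mult pderiv_pCons pderiv_monom pderiv_diff pderiv_smult poly_monom)
  also have "e (2 * j) ^ (p - 1) = e (- 2 * j)"
    using p_gt_2 by (simp add: e_power e_eq_iff cong_iff_dvd_diff algebra_simps of_nat_diff)
  finally show ?thesis by (simp add: poly_prod)
qed

lemma x_power: "x i ^ a = e (2 * int i * int a)" and y_power: "y i ^ a = e (- 2 * int i * int a)"
  by (simp_all add: x_def y_def e_power)

text \<open>This is the identity for \<open>P'(x j) * P(y j)\<close> with
  \<open>d j = 1 / P'(x j)\<close> moved to the right. \<open>prod_root_differences\<close> splits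
  into \<open>P'(x j)\<close> and the product \<open>Q\<close> over negative exponents; the relation
  \<open>x j - y k = - x j * y k * (y j - x k)\<close> then turns \<open>Q\<close> into
  \<open>W\<close>, which is \<open>P(y j)\<close> without the node \<open>x 0\<close>.\<close>

lemma prod_y_minus_x:
  assumes j: "j \<le> n"
  shows "(\<Prod>k\<le>n. y j - x k) = of_nat p * e (int n div 2) * d j * e (- int j) * (e (- 2 * int j) - 1)"
proof -
  define Q where "Q = (\<Prod>k=1..n. x j - y k)"
  define W where "W = (\<Prod>k=1..n. y j - x k)"
  have d_nz: "(\<Prod>k\<in>{..n} - {j}. x j - x k) * d j = 1"
  proof -
    have "(\<Prod>k\<in>{..n} - {j}. x j - x k) * d j = (\<Prod>k\<in>{..n} - {j}. (x j - x k) * (1 / (x j - x k)))"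
      unfolding d_def by (rule prod.distrib[symmetric])
    also have "\<dots> = 1"
      using inj_x j by (intro prod.neutral ballI) (auto simp: inj_on_def)
    finally show ?thesis .
  qed
  have split: "{- int n..int n} - {int j} = int ` ({..n} - {j}) \<union> (\<lambda>k. - int k) ` {1..n}"
  proof -
    have *: "k \<in> (\<lambda>k. - int k) ` {1..n}" if "k < 0" "- int n \<le> k" for k
      using that by (intro image_eqI[of _ _ "nat (- k)"]) auto
    have **: "k \<in> int ` ({..n} - {j})" if "0 \<le> k" "k \<le> int n" "k \<noteq> int j" for k
      using that by (intro image_eqI[of _ _ "nat k"]) auto
    show ?thesis
    proof (intro equalityI subsetI)
      fix k assume "k \<in> {- int n..int n} - {int j}"
      then show "k \<in> int ` ({..n} - {j}) \<union> (\<lambda>k. - int k) ` {1..n}"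
        by (cases "k < 0") (use * ** in auto)
    qed auto
  qed
  have "of_nat p * e (- 2 * int j) = (\<Prod>k\<in>{- int n..int n} - {int j}. e (2 * int j) - e (2 * k))"
    using j by (subst prod_root_differences) auto
  also have "\<dots> = (\<Prod>k\<in>int ` ({..n} - {j}). e (2 * int j) - e (2 * k))
      * (\<Prod>k\<in>(\<lambda>k. - int k) ` {1..n}. e (2 * int j) - e (2 * k))"
    unfolding split by (rule prod.union_disjoint) auto
  also have "(\<Prod>k\<in>int ` ({..n} - {j}). e (2 * int j) - e (2 * k)) = (\<Prod>k\<in>{..n} - {j}. x j - x k)"
    by (subst prod.reindex) (auto simp: x_def)
  also have "(\<Prod>k\<in>(\<lambda>k. - int k) ` {1..n}. e (2 * int j) - e (2 * k)) = Q"
    unfolding Q_def by (subst prod.reindex) (auto simp: x_def y_def inj_on_def)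
  finally have PQ: "(\<Prod>k\<in>{..n} - {j}. x j - x k) * Q = of_nat p * e (- 2 * int j)" by simp
  have "Q = of_nat p * e (- 2 * int j) * d j"
  proof -
    have "Q = ((\<Prod>k\<in>{..n} - {j}. x j - x k) * d j) * Q" by (simp add: d_nz)
    also have "\<dots> = ((\<Prod>k\<in>{..n} - {j}. x j - x k) * Q) * d j" by (simp add: mult_ac)
    finally show ?thesis by (simp only: PQ)
  qed
  moreover have "Q = e (- int j) * e (- (int n div 2)) * W"
  proof -
    have "Q = (\<Prod>k=1..n. (- 1) * x j * y k * (y j - x k))"
      unfolding Q_def
      by (rule prod.cong) (simp_all add: x_def y_def algebra_simps flip: e_add)
    also have "\<dots> = (- 1) ^ n * x j ^ n * (\<Prod>k=1..n. y k) * W"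
      by (simp only: W_def prod.distrib prod_constant card_atLeastAtMost diff_Suc_1)
    also have "(- 1) ^ n = (1::complex)" using even_n by simp
    \<comment> \<open>\<open>2 * n \<equiv> -1\<close> modulo \<open>p\<close>.\<close>
    also have "x j ^ n = e (- int j)"
    proof -
      have "2 * int j * int n - (- int j) = int p * int j" by (simp add: int_p_eq algebra_simps)
      then show ?thesis unfolding x_power e_eq_iff cong_iff_dvd_diff by simp
    qed
    also have "(\<Prod>k=1..n. y k) = e (- (int n * (int n + 1)))"
    proof -
      have "(\<Prod>k=1..m. y k) = e (- (int m * (int m + 1)))" for m
        by (induction m) (simp_all add: y_def algebra_simps flip: e_add)
      then show ?thesis .
    qed
    \<comment> \<open>With \<open>n = 2 * m\<close> and \<open>p = 4 * m + 1\<close> one has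
      \<open>n * (n + 1) - m = p * m\<close>. This is where the exponent \<open>(p - 1) / 4\<close>
      of the theorem comes from.\<close>
    also have "e (- (int n * (int n + 1))) = e (- (int n div 2))"
    proof -
      obtain m where m: "n = 2 * m" using even_n by (elim evenE)
      have "- (int n * (int n + 1)) - (- int m) = int p * (- int m)"
        by (simp add: int_p_eq m algebra_simps)
      then have "[- (int n * (int n + 1)) = - int m] (mod int p)"
        unfolding cong_iff_dvd_diff by simp
      then show ?thesis by (simp add: m e_eq_iff)
    qed
    finally show ?thesis by simp
  qed
  ultimately have "W = of_nat p * e (int n div 2) * d j * e (- int j)"
  proof -
    assume Q: "Q = of_nat p * e (- 2 * int j) * d j" "Q = e (- int j) * e (- (int n div 2)) * W"
    have "W = e (int j) * e (int n div 2) * (e (- int j) * e (- (int n div 2)) * W)"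
      by (simp add: e_minus field_simps)
    also have "\<dots> = of_nat p * e (int n div 2) * d j * (e (int j) * e (- 2 * int j))"
      unfolding Q(2)[symmetric] Q(1) by (simp only: mult_ac)
    also have "e (int j) * e (- 2 * int j) = e (- int j)"
      by (simp flip: e_add)
    finally show ?thesis .
  qed
  moreover have "(\<Prod>k\<le>n. y j - x k) = W * (e (- 2 * int j) - 1)"
  proof -
    have "{..n} = insert 0 {1..n}" by auto
    then show ?thesis by (simp add: W_def x_def y_def)
  qed
  ultimately show ?thesis by simp
qed

section \<open>The coefficients of \<open>DUD\<close>\<close>

lemma e_eq_pm_1:
  assumes "\<not> int p dvd k"
  shows "e k \<noteq> 1" and "e k \<noteq> - 1"
proof -
  show "e k \<noteq> 1" using assms by (simp add: e_eq_1_iff)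
  have "e (2 * k) \<noteq> 1"
    using assms two_mult_cong[of k 0] by (simp add: e_eq_1_iff cong_0_iff)
  moreover have "e (2 * k) = e k * e k" by (simp flip: e_add)
  ultimately show "e k \<noteq> - 1" by auto
qed

text \<open>For \<open>i, j > 0\<close> the fraction is extended by \<open>a * b - r * s\<close>,
  and \<open>r\<^sup>2 = s\<^sup>2 = 1\<close> turns the denominator into
  \<open>(a * b)\<^sup>2 - 1\<close>. If one index is 0, its symbol is 0 and its power of \<zeta> is
  1, and the fraction simplifies directly.\<close>

lemma u_rationalised:
  assumes "i \<le> n" "j \<le> n" "i + j > 0"
  shows "u i j * (e (- 2 * int i - 2 * int j) - 1)
    = chi (int i) * e (- 2 * int j - int i) * (e (- 2 * int i) - 1)
      + chi (int j) * e (- int j - 2 * int i) * (e (- 2 * int j) - 1)"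
proof -
  define a b where "a = e (- int i)" and "b = e (- int j)"
  have nd: "\<not> int p dvd int k" if "0 < k" "k < p" for k
    using that by (auto dest: zdvd_imp_le)
  have chi_cases: "chi (int k) = 0 \<and> k = 0 \<or> chi (int k) * chi (int k) = 1" if "k \<le> n" for k
  proof -
    have "k < p" using that p_eq by linarith
    then show ?thesis using chi_sq[of "int k"] nd[of k] by (cases "k = 0") auto
  qed
  have ab: "a * b = e (- (int i + int j))" by (simp add: a_def b_def flip: e_add)
  have "\<not> int p dvd - (int i + int j)"
    using nd[of "i + j"] assms p_eq by (simp del: minus_add_distrib)
  then have ab1: "a * b \<noteq> 1" "a * b \<noteq> - 1" unfolding ab by (rule e_eq_pm_1)+
  have pow: "e (- int j - 2 * int i) = b * a * a" "e (- 2 * int j - int i) = b * b * a"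
    "e (- int i - int j) = a * b" "e (- 2 * int i) = a * a" "e (- 2 * int j) = b * b"
    "e (- 2 * int i - 2 * int j) = a * b * (a * b)"
    unfolding a_def b_def e_add[symmetric] by (rule arg_cong[of _ _ e]; simp)+
  have nz: "a \<noteq> 0" "b \<noteq> 0" by (simp_all add: a_def b_def)
  define r s where "r = chi (int i)" and "s = chi (int j)"
  have u: "u i j = (r * (b * a * a) + s * (b * b * a)) / (a * b + r * s)"
    unfolding u_def pow r_def s_def ..
  have rs: "r = 0 \<and> i = 0 \<or> r * r = 1" "s = 0 \<and> j = 0 \<or> s * s = 1"
    using chi_cases assms by (simp_all add: r_def s_def)
  consider "r * r = 1" "s * s = 1" | "r = 0" "a = 1" | "s = 0" "b = 1"
    using rs by (auto simp: a_def b_def)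
  then show ?thesis
  proof cases
    case 1
    have "(a * b + r * s) * (a * b - r * s) = a * b * (a * b) - (r * r) * (s * s)"
      by (simp add: algebra_simps)
    then have f: "(a * b + r * s) * (a * b - r * s) = a * b * (a * b) - 1" using 1 by simp
    moreover have "a * b * (a * b) - 1 \<noteq> 0" using ab1 by (simp add: square_eq_1_iff)
    ultimately have den: "a * b + r * s \<noteq> 0" by auto
    have "u i j * (a * b * (a * b) - 1) = (r * (b * a * a) + s * (b * b * a)) * (a * b - r * s)"
      unfolding f[symmetric] u using den by simp
    also have "\<dots> = r * (b * b * a) * (a * a) + s * (b * a * a) * (b * b)
        - (r * r) * s * (b * a * a) - (s * s) * r * (b * b * a)"
      by (simp add: algebra_simps)
    also have "\<dots> = r * (b * b * a) * (a * a - 1) + s * (b * a * a) * (b * b - 1)"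
      unfolding 1 by (simp add: algebra_simps)
    finally show ?thesis unfolding pow r_def s_def .
  next
    case 2
    then show ?thesis unfolding pow u r_def[symmetric] s_def[symmetric] using nz
      by (simp add: field_simps)
  next
    case 3
    then show ?thesis unfolding pow u r_def[symmetric] s_def[symmetric] using nz
      by (simp add: field_simps)
  qed
qed

text \<open>Multiplication by \<open>E = y i * y j - 1\<close> restores the omitted factor, as
  \<open>y j - x i = x i * E\<close>. The completed products are given by
  \<open>prod_y_minus_x\<close>, and their combination is the right-hand side of
  \<open>u_rationalised\<close>.\<close>

lemma u_coefficient:
  assumes i: "i \<le> n" and j: "j \<le> n"
  shows "chi (int j) * d i * (\<Prod>k\<in>{..n} - {i}. y j - x k) + chi (int i) * d j * (\<Prod>k\<in>{..n} - {j}. y i - x k)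
    = of_nat p * e (int n div 2) * (d i * u i j * d j)"
proof (cases "i + j = 0")
  case True
  \<comment> \<open>For \<open>i = j = 0\<close> the factor \<open>E\<close> would vanish, but both
    sides are 0 because \<open>chi 0 = 0\<close>.\<close>
  then show ?thesis by (simp add: u_def)
next
  case False
  define M where "M i j = (\<Prod>k\<in>{..n} - {i}. y j - x k)" for i j
  define E where "E = e (- 2 * int i - 2 * int j) - 1"
  have "\<not> int p dvd - int i - int j"
  proof
    assume "int p dvd - int i - int j"
    moreover have "- int i - int j = - (int i + int j)" by simp
    ultimately have "[int i + int j = 0] (mod int p)" by (simp only: cong_0_iff dvd_minus_iff)
    then show False using cong_small[of "int i + int j" 0] False i j int_p_eq by simp
  qed
  then have "e (2 * (- int i - int j)) \<noteq> 1"
    using two_mult_cong[of "- int i - int j" 0] by (simp add: e_eq_1_iff cong_0_iff)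
  then have E: "E \<noteq> 0" by (simp add: E_def algebra_simps)
  have M: "M i j * E = of_nat p * e (int n div 2) * d j * e (- int j - 2 * int i) * (e (- 2 * int j) - 1)"
    if "i \<le> n" "j \<le> n" "E = e (- 2 * int i - 2 * int j) - 1" for i j
  proof -
    have "y j - x i = e (2 * int i) * E"
      unfolding that(3) y_def x_def by (simp add: algebra_simps flip: e_add)
    then have "M i j * E * e (2 * int i) = M i j * (y j - x i)" by simp
    also have "\<dots> = (\<Prod>k\<le>n. y j - x k)"
      unfolding M_def using that by (simp add: prod.remove[of "{..n}" i])
    also have "\<dots> = of_nat p * e (int n div 2) * d j * e (- int j) * (e (- 2 * int j) - 1)"
      using that by (intro prod_y_minus_x)
    also have "e (- int j) = e (- int j - 2 * int i) * e (2 * int i)"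
      by (simp flip: e_add)
    finally show ?thesis by simp
  qed
  have "(chi (int j) * d i * M i j + chi (int i) * d j * M j i) * E
      = chi (int j) * d i * (M i j * E) + chi (int i) * d j * (M j i * E)"
    by (simp add: algebra_simps)
  also have "\<dots> = of_nat p * e (int n div 2) * d i * d j *
      (chi (int i) * e (- 2 * int j - int i) * (e (- 2 * int i) - 1)
      + chi (int j) * e (- int j - 2 * int i) * (e (- 2 * int j) - 1))"
  proof -
    have "- 2 * int i - 2 * int j = - 2 * int j - 2 * int i" by simp
    then have "E = e (- 2 * int j - 2 * int i) - 1" by (simp only: E_def)
    then have Mji: "M j i * E = of_nat p * e (int n div 2) * d i * e (- int i - 2 * int j) * (e (- 2 * int i) - 1)"
      by (rule M[OF j i])
    have *: "- int i - 2 * int j = - 2 * int j - int i" by simp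
    show ?thesis unfolding Mji * M[OF i j E_def] by (simp only: ring_distribs mult_ac add_ac)
  qed
  also have "\<dots> = of_nat p * e (int n div 2) * (d i * u i j * d j) * E"
    unfolding u_rationalised[OF i j, symmetric, unfolded neq0_conv[symmetric], OF False] E_def
    by (simp add: mult_ac)
  finally show ?thesis using E unfolding M_def by simp
qed

lemma chi_diff_eq:
  assumes a: "a \<le> n" and b: "b \<le> n"
  shows "chi (int b - int a) = gauss_sum p 2 * e (int n div 2) *
    (\<Sum>i\<le>n. \<Sum>j\<le>n. x i ^ a * (d i * u i j * d j) * x j ^ b)"
proof -
  define t where "t = gauss_sum p 2"
  define M where "M i j = (\<Prod>k\<in>{..n} - {i}. y j - x k)" for i j
  have nd2: "\<not> int p dvd 2" using p_gt_2 by (auto dest: zdvd_imp_le)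
  have tt: "t * t = of_nat p"
  proof -
    have "t * t = (chi 2 * chi 2) * (gauss_sum p 1 * gauss_sum p 1)"
      unfolding t_def gauss_sum_mult[of 2] by (simp add: mult_ac)
    then show ?thesis using nd2 by (simp add: chi_sq gauss_sum_sq)
  qed
  have interp: "y k ^ a = (\<Sum>i\<le>n. x i ^ a * d i * M i k)" if "a \<le> n" for k a
    unfolding d_def M_def by (rule lagrange_interpolation_power[OF inj_x that])
  \<comment> \<open>Apply \<open>sum_chi_e\<close> with \<open>m = 2 * (b - a)\<close>; the factor 2
    produces powers of the nodes.\<close>
  have t: "t * chi (int b - int a) = (\<Sum>k\<in>{0..<int p}. chi k * e (k * (2 * (int b - int a))))"
    unfolding t_def gauss_sum_mult[of 2] sum_chi_e chi_mult by (simp add: mult_ac)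
  also have "\<dots> = (\<Sum>k=1..n. chi (int k) * e (int k * (2 * (int b - int a)))
      + chi (- int k) * e (- int k * (2 * (int b - int a))))"
  proof (subst sum_residues_centered)
    show "chi (k mod int p) * e (k mod int p * (2 * (int b - int a)))
        = chi k * e (k * (2 * (int b - int a)))" for k
    proof -
      have "e (k mod int p * (2 * (int b - int a))) = e (k * (2 * (int b - int a)))"
        unfolding e_eq_iff by (intro cong_mult) auto
      then show ?thesis by (simp add: chi_mod)
    qed
  qed simp
  also have "\<dots> = (\<Sum>k=1..n. chi (int k) * (y k ^ a * x k ^ b + x k ^ a * y k ^ b))"
    by (intro sum.cong refl) (simp add: x_power y_power algebra_simps flip: e_add)
  \<comment> \<open>The term \<open>k = 0\<close> may be added since \<open>chi 0 = 0\<close>; the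
    sum now runs over all nodes.\<close>
  also have "\<dots> = (\<Sum>k\<le>n. chi (int k) * (y k ^ a * x k ^ b + x k ^ a * y k ^ b))"
    by (rule sum.mono_neutral_left) (auto simp: not_le less_Suc_eq_0_disj Suc_le_eq)
  also have "\<dots> = (\<Sum>k\<le>n. \<Sum>i\<le>n. x i ^ a * (chi (int k) * d i * M i k) * x k ^ b)
      + (\<Sum>k\<le>n. \<Sum>i\<le>n. x k ^ a * (chi (int k) * d i * M i k) * x i ^ b)"
    unfolding interp[OF a] interp[OF b]
    by (simp add: sum_distrib_left sum_distrib_right sum.distrib ring_distribs mult_ac)
  \<comment> \<open>Only the first double sum is transposed, so that both carry
    \<open>x i ^ a\<close> and \<open>x j ^ b\<close>.\<close>
  also have "(\<Sum>k\<le>n. \<Sum>i\<le>n. x i ^ a * (chi (int k) * d i * M i k) * x k ^ b)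
      = (\<Sum>i\<le>n. \<Sum>j\<le>n. x i ^ a * (chi (int j) * d i * M i j) * x j ^ b)"
    by (rule sum.swap)
  also have "\<dots> + (\<Sum>i\<le>n. \<Sum>j\<le>n. x i ^ a * (chi (int i) * d j * M j i) * x j ^ b)
      = (\<Sum>i\<le>n. \<Sum>j\<le>n. x i ^ a * (chi (int j) * d i * M i j + chi (int i) * d j * M j i) * x j ^ b)"
    by (simp add: sum.distrib ring_distribs)
  also have "\<dots> = (\<Sum>i\<le>n. \<Sum>j\<le>n. x i ^ a * (of_nat p * e (int n div 2) * (d i * u i j * d j)) * x j ^ b)"
    by (intro sum.cong refl) (simp only: M_def u_coefficient atMost_iff)
  also have "\<dots> = of_nat p * e (int n div 2) * (\<Sum>i\<le>n. \<Sum>j\<le>n. x i ^ a * (d i * u i j * d j) * x j ^ b)"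
    by (simp add: sum_distrib_left mult_ac)
  \<comment> \<open>Writing \<open>p = t * t\<close> makes one factor \<open>t\<close>
    cancel.\<close>
  also have "\<dots> = t * (t * e (int n div 2) * (\<Sum>i\<le>n. \<Sum>j\<le>n. x i ^ a * (d i * u i j * d j) * x j ^ b))"
    unfolding tt[symmetric] by (simp only: mult.assoc)
  finally have "t * chi (int b - int a)
      = t * (t * e (int n div 2) * (\<Sum>i\<le>n. \<Sum>j\<le>n. x i ^ a * (d i * u i j * d j) * x j ^ b))" .
  moreover have "t \<noteq> 0" using tt p_gt_2 by auto
  ultimately show ?thesis unfolding t_def by simp
qed

section \<open>Assembly of the matrix identity\<close>

theorem matC_factorization:
  "matC p = (gauss_sum p 2 * zeta p ^ ((p - 1) div 4))
     \<cdot>\<^sub>m (matV p * matD p * matU p * matD p * matV p)" (is "_ = ?c \<cdot>\<^sub>m _")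
proof -
  define V where "V = mat (n + 1) (n + 1) (\<lambda>(i, j). x i ^ j)"
  define U where "U = mat (n + 1) (n + 1) (\<lambda>(i, j). u i j)"
  have D: "matD p = mat_diag (n + 1) d"
    unfolding matD_def Let_def n_def[symmetric] d_def x_def e_def
    by (intro arg_cong2[of _ _ _ _ mat_diag] refl ext) (simp add: atMost_atLeast0 power_int_def nat_mult_distrib)
  \<comment> \<open>\<open>matV p\<close> is symmetric; the node is the row index when it multiplies
    from the right and the column index when it multiplies from the left.\<close>
  have V: "matV p = V" "matV p = mat (n + 1) (n + 1) (\<lambda>(i, j). x j ^ i)"
    unfolding matV_def Let_def n_def[symmetric] V_def x_power
    by (intro cong_mat refl; simp add: e_def power_int_def nat_mult_distrib mult_ac)+
  have U: "matU p = U"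
    unfolding matU_def Let_def n_def[symmetric] U_def u_def e_def ..
  have C: "matC p = mat (n + 1) (n + 1) (\<lambda>(i, j). chi (int j - int i))"
    unfolding matC_def Let_def n_def[symmetric] ..
  define W where "W = matV p * matD p * matU p"
  have VD: "matV p * matD p = mat (n + 1) (n + 1) (\<lambda>(a, i). x i ^ a * d i)"
    unfolding D V(2) by (subst mat_diag_mult_right) (auto intro!: cong_mat)
  have W: "W \<in> carrier_mat (n + 1) (n + 1)"
    unfolding W_def VD U U_def by (intro mult_carrier_mat) auto
  have W_entry: "W $$ (a, j) = (\<Sum>i\<le>n. x i ^ a * d i * u i j)" if "a \<le> n" "j \<le> n" for a j
    using that unfolding W_def VD U U_def
    by (simp add: scalar_prod_def atLeast0_lessThan_Suc lessThan_Suc_atMost atLeast0LessThan)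
  have WD: "W * matD p = mat (n + 1) (n + 1) (\<lambda>(a, j). W $$ (a, j) * d j)"
    unfolding D using W by (rule mat_diag_mult_right)
  have entry: "(W * matD p * matV p) $$ (a, b) = (\<Sum>i\<le>n. \<Sum>j\<le>n. x i ^ a * (d i * u i j * d j) * x j ^ b)"
    if "a \<le> n" "b \<le> n" for a b
  proof -
    have "(W * matD p * matV p) $$ (a, b) = (\<Sum>j\<le>n. W $$ (a, j) * d j * x j ^ b)"
      using that unfolding WD V(1) V_def
      by (simp add: scalar_prod_def atLeast0LessThan lessThan_Suc_atMost)
    also have "\<dots> = (\<Sum>j\<le>n. \<Sum>i\<le>n. x i ^ a * (d i * u i j * d j) * x j ^ b)"
      using that by (intro sum.cong refl) (simp add: W_entry sum_distrib_left sum_distrib_right mult_ac)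
    also have "\<dots> = (\<Sum>i\<le>n. \<Sum>j\<le>n. x i ^ a * (d i * u i j * d j) * x j ^ b)"
      by (rule sum.swap)
    finally show ?thesis .
  qed
  have c: "?c = gauss_sum p 2 * e (int n div 2)"
  proof -
    have "(p - 1) div 4 = n div 2" by (simp add: n_def div_mult2_eq[symmetric])
    then show ?thesis by (simp add: e_def power_int_def nat_div_distrib)
  qed
  have "matC p = ?c \<cdot>\<^sub>m (W * matD p * matV p)"
  proof (rule eq_matI)
    fix a b assume "a < dim_row (?c \<cdot>\<^sub>m (W * matD p * matV p))" "b < dim_col (?c \<cdot>\<^sub>m (W * matD p * matV p))"
    then have ab: "a \<le> n" "b \<le> n" by (simp_all add: WD V V_def)
    then show "matC p $$ (a, b) = (?c \<cdot>\<^sub>m (W * matD p * matV p)) $$ (a, b)"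
      unfolding c using chi_diff_eq[OF ab] entry[OF ab]
      by (simp add: C WD V V_def)
  qed (simp_all add: C WD V V_def)
  then show ?thesis by (simp only: W_def)
qed

section \<open>The sign of the Gauss sum\<close>

definition dft :: "complex mat" where
  "dft = mat p p (\<lambda>(i, j). e (int i * int j))"

lemma dft_carrier: "dft \<in> carrier_mat p p"
  by (simp add: dft_def)

lemma sum_nat_e: "(\<Sum>k<p. e (int k * m)) = (if int p dvd m then of_nat p else 0)"
proof -
  have "(\<Sum>k<p. e (int k * m)) = (\<Sum>k\<in>{0..<int p}. e (k * m))"
    by (rule sum.reindex_bij_witness[of _ nat int]) auto
  then show ?thesis by (simp only: sum_e)
qed

lemma dft_square: "dft * dft = mat p p (\<lambda>(i, j). if p dvd i + j then of_nat p else 0)"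
proof (rule eq_matI)
  fix i j assume ij: "i < dim_row (mat p p (\<lambda>(i, j). if p dvd i + j then of_nat p else 0))"
    "j < dim_col (mat p p (\<lambda>(i, j). if p dvd i + j then of_nat p else 0))"
  then have "(dft * dft) $$ (i, j) = (\<Sum>k<p. e (int i * int k) * e (int k * int j))"
    by (simp add: dft_def scalar_prod_def atLeast0LessThan)
  also have "\<dots> = (\<Sum>k<p. e (int k * int (i + j)))"
    by (intro sum.cong refl) (simp add: algebra_simps flip: e_add)
  also have "\<dots> = (if p dvd i + j then of_nat p else 0)"
    unfolding sum_nat_e by (simp only: int_dvd_int_iff)
  finally show "(dft * dft) $$ (i, j) = mat p p (\<lambda>(i, j). if p dvd i + j then of_nat p else 0) $$ (i, j)"
    using ij by simp
qed (simp_all add: dft_def)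

text \<open>\<open>dft * dft\<close> is \<open>p\<close> times the permutation matrix of negation
  modulo \<open>p\<close>, which is an involution.\<close>

lemma dft_power_4: "dft * dft * (dft * dft) = (of_nat p)\<^sup>2 \<cdot>\<^sub>m 1\<^sub>m p"
proof (rule eq_matI)
  fix i j assume "i < dim_row ((of_nat p)\<^sup>2 \<cdot>\<^sub>m 1\<^sub>m p :: complex mat)" "j < dim_col ((of_nat p)\<^sup>2 \<cdot>\<^sub>m 1\<^sub>m p :: complex mat)"
  then have ij: "i < p" "j < p" by simp_all
  \<comment> \<open>The representative of \<open>- i\<close> in \<open>{0..<p}\<close>.\<close>
  define r where "r = (if i = 0 then 0 else p - i)"
  have dvd: "p dvd i + k \<longleftrightarrow> k = r" if "k < p" for k
  proof
    assume "p dvd i + k"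
    then obtain q where q: "i + k = p * q" by (elim dvdE)
    have "p * q < p * 2" using q that ij by linarith
    then have "q < 2" by simp
    then have "q = 0 \<or> q = 1" by linarith
    then show "k = r" using q that by (auto simp: r_def)
  qed (use ij in \<open>auto simp: r_def\<close>)
  have dvd': "p dvd r + j \<longleftrightarrow> i = j"
  proof (cases "i = 0")
    case True
    then show ?thesis using ij by (auto simp: r_def dest: dvd_imp_le)
  next
    case False
    have "p dvd r + j \<longleftrightarrow> int p dvd int (r + j)" by (simp only: int_dvd_int_iff)
    also have "int (r + j) = int p + (int j - int i)" using False ij by (simp add: r_def)
    also have "int p dvd \<dots> \<longleftrightarrow> int p dvd int j - int i" by simp
    also have "\<dots> \<longleftrightarrow> i = j"
    proof
      assume "int p dvd int j - int i"
      then have "int j mod int p = int i mod int p" by (simp add: mod_eq_dvd_iff)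
      then show "i = j" using ij by simp
    qed simp
    finally show ?thesis .
  qed
  have r: "r < p" using ij by (auto simp: r_def)
  have "(dft * dft * (dft * dft)) $$ (i, j)
      = (\<Sum>k<p. (if p dvd i + k then of_nat p else 0) * (if p dvd k + j then of_nat p else 0))"
    unfolding dft_square using ij by (simp add: scalar_prod_def atLeast0LessThan)
  also have "\<dots> = (\<Sum>k<p. if k = r then of_nat p * (if p dvd r + j then of_nat p else 0) else 0)"
    by (intro sum.cong refl) (simp add: dvd)
  also have "\<dots> = ((of_nat p)\<^sup>2 \<cdot>\<^sub>m 1\<^sub>m p) $$ (i, j)"
    using r ij by (simp add: dvd' power2_eq_square)
  finally show "(dft * dft * (dft * dft)) $$ (i, j) = ((of_nat p)\<^sup>2 \<cdot>\<^sub>m 1\<^sub>m p) $$ (i, j)" .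
qed (simp_all add: dft_def)

text \<open>The diagonal entries are \<open>e (i\<^sup>2)\<close>. In the weight
  \<open>1 + chi k\<close> of \<open>sum_squares\<close>, the constant part contributes the sum of
  all \<open>p\<close>-th roots of unity, which is 0.\<close>

lemma mat_trace_dft: "mat_trace dft = gauss_sum p 1"
proof -
  have "mat_trace dft = (\<Sum>x\<in>{0..<int p}. e (x\<^sup>2))"
    unfolding mat_trace_def dft_def
    by (rule sum.reindex_bij_witness[of _ nat int]) (auto simp: power2_eq_square)
  also have "\<dots> = (\<Sum>k\<in>{0..<int p}. (1 + chi k) * e k)"
    by (rule sum_squares) (rule e_mod)
  also have "\<dots> = (\<Sum>k\<in>{0..<int p}. e (k * 1)) + gauss_sum p 1"
    by (simp add: gauss_sum_eq ring_distribs sum.distrib)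
  also have "(\<Sum>k\<in>{0..<int p}. e (k * 1)) = 0"
    using p_gt_2 unfolding sum_e by (auto dest: zdvd_imp_le)
  finally show ?thesis by simp
qed

lemma mat_trace_dft_square: "mat_trace (dft * dft) = of_nat p"
proof -
  have "p dvd i + i \<longleftrightarrow> i = 0" if "i < p" for i
  proof
    assume "p dvd i + i"
    then have "p dvd 2 * i" by (simp add: mult_2)
    moreover have "coprime p 2" using p_eq by simp
    ultimately have "p dvd i" by (simp add: coprime_dvd_mult_right_iff)
    then show "i = 0" using that by (auto dest: dvd_imp_le)
  qed simp
  then have "mat_trace (dft * dft) = (\<Sum>i<p. if i = 0 then of_nat p else 0)"
    unfolding dft_square mat_trace_def by (auto intro!: sum.cong)
  then show ?thesis using p_gt_2 by simp
qed

text \<open>Each Vandermonde factor is a midpoint phase times \<i> times a real number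
  \<open>2 * sin t\<close> with \<open>0 < t < pi\<close>. The phases add up to the multiple
  \<open>2 * pi * n\<^sup>2\<close>, and the \<open>p * n\<close> factors \<i> multiply to
  \<open>(- 1) ^ (n div 2)\<close>.\<close>

lemma det_dft: "\<exists>r>0. det dft = (- 1) ^ (n div 2) * complex_of_real r"
proof -
  define S where "S = (\<Prod>i<p. \<Prod>k<i. 2 * sin (pi * (real i - real k) / real p))"
  have e_diff_e: "e (int i) - e (int k) = cis (pi / real p * (real i + real k)) *
      (\<i> * complex_of_real (2 * sin (pi * (real i - real k) / real p)))" for i k
  proof -
    have "(2 * pi * of_int (int i) / real p + 2 * pi * of_int (int k) / real p) / 2
        = pi / real p * (real i + real k)"
      "(2 * pi * of_int (int i) / real p - 2 * pi * of_int (int k) / real p) / 2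
        = pi * (real i - real k) / real p"
      by (simp_all add: add_divide_distrib diff_divide_distrib algebra_simps)
    then show ?thesis unfolding e_cis cis_diff_cis by simp
  qed
  have "dft = mat p p (\<lambda>(i, j). e (int i) ^ j)"
    by (simp add: dft_def e_power)
  then have "det dft = (\<Prod>i<p. \<Prod>k<i. e (int i) - e (int k))"
    by (simp add: det_vandermonde)
  also have "\<dots> = cis (pi / real p * (\<Sum>i<p. \<Sum>k<i. real i + real k)) * \<i> ^ (\<Sum>i<p. i) * complex_of_real S"
    unfolding e_diff_e prod.distrib prod_cis S_def sum_distrib_left[symmetric]
    by (simp add: power_sum mult.assoc)
  also have "pi / real p * (\<Sum>i<p. \<Sum>k<i. real i + real k) = 2 * pi * of_nat (n * n)"
  proof -
    have "2 * (\<Sum>i<p. \<Sum>k<i. real i + real k) = real p * (2 * real n)\<^sup>2"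
      unfolding sum_sum_add using p_eq by simp
    then have "(\<Sum>i<p. \<Sum>k<i. real i + real k) = real p * (2 * real n * real n)"
      by (simp add: power2_eq_square)
    then show ?thesis using p_gt_2 by simp
  qed
  also have "cis (2 * pi * of_nat (n * n)) = 1"
    by (rule cis_multiple_2pi) simp
  also have "\<i> ^ (\<Sum>i<p. i) = (- 1) ^ (n div 2)"
  proof -
    obtain m where m: "n = 2 * m" using even_n by (elim evenE)
    have "(\<Sum>i<p. i) = p * n"
      unfolding p_eq by (induction n) (simp_all add: algebra_simps)
    then have "\<i> ^ (\<Sum>i<p. i) = ((\<i> ^ 2) ^ p) ^ m"
      by (simp only: m power_mult[symmetric] mult_ac)
    also have "(\<i> ^ 2) ^ p = - 1" using p_eq by simp
    finally show ?thesis by (simp add: m)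
  qed
  finally have "det dft = (- 1) ^ (n div 2) * complex_of_real S" by simp
  moreover have "S > 0" unfolding S_def
  proof (intro prod_pos)
    fix i k assume "i \<in> {..<p}" "k \<in> {..<i}"
    then have "0 < real i - real k" "real i - real k < real p" by auto
    then have "0 < pi * (real i - real k) / real p" "pi * (real i - real k) / real p < pi"
      by (simp_all add: divide_less_eq)
    then show "0 < 2 * sin (pi * (real i - real k) / real p)" by (simp add: sin_gt_zero)
  qed
  ultimately show ?thesis by blast
qed

theorem gauss_sum_eq_sqrt: "gauss_sum p 1 = complex_of_real (sqrt (real p))"
proof -
  define s where "s = complex_of_real (sqrt (real p))"
  have ss: "s * s = of_nat p" unfolding s_def by (simp flip: of_real_mult)
  have s0: "s \<noteq> 0" using p_gt_2 by (simp add: s_def)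
  obtain l where l: "mat_trace dft = (\<Sum>i<p. l i)" "mat_trace (dft * dft) = (\<Sum>i<p. (l i)\<^sup>2)"
    "det dft = (\<Prod>i<p. l i)" "\<And>i. i < p \<Longrightarrow> l i ^ 4 = (of_nat p)\<^sup>2"
    using triangular_spectrum[OF dft_carrier] dft_power_4 by metis
  \<comment> \<open>Eigenvalues scaled by the square root of \<open>p\<close> are fourth roots of
    unity; \<open>N\<close> counts their multiplicities.\<close>
  define \<mu> where "\<mu> i = l i / s" for i
  define N where "N v = card {i \<in> {..<p}. \<mu> i = v}" for v
  let ?R = "{1, - 1, \<i>, - \<i>}"
  have R: "\<mu> ` {..<p} \<subseteq> ?R"
  proof (rule image_subsetI)
    fix i assume "i \<in> {..<p}"
    then have "l i ^ 4 = (s * s)\<^sup>2" using l(4) by (simp add: ss)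
    then have "\<mu> i ^ 4 = 1" using s0 by (simp add: \<mu>_def power_divide power4_eq_xxxx power2_eq_square)
    then show "\<mu> i \<in> ?R" by (rule fourth_root_of_unity)
  qed
  have sum_mu: "(\<Sum>i<p. f (\<mu> i)) = (\<Sum>v\<in>?R. of_nat (N v) * f v)" for f :: "complex \<Rightarrow> complex"
  proof -
    have "(\<Sum>i<p. f (\<mu> i)) = (\<Sum>v\<in>?R. \<Sum>i | i \<in> {..<p} \<and> \<mu> i = v. f (\<mu> i))"
      by (rule sum.group[symmetric]) (use R in auto)
    then show ?thesis by (simp add: N_def)
  qed
  have prod_mu: "(\<Prod>i<p. \<mu> i) = (\<Prod>v\<in>?R. v ^ N v)"
  proof -
    have "(\<Prod>i<p. \<mu> i) = (\<Prod>v\<in>?R. \<Prod>i | i \<in> {..<p} \<and> \<mu> i = v. \<mu> i)"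
      by (rule prod.group[symmetric]) (use R in auto)
    then show ?thesis by (simp add: N_def)
  qed
  have distinct: "\<i> \<noteq> - 1" "- \<i> \<noteq> 1" "1 \<noteq> - \<i>" "\<i> \<noteq> - \<i>" "- \<i> \<noteq> \<i>" "- 1 \<noteq> \<i>"
    by (simp_all add: complex_eq_iff)
  define a b c d where abcd: "a = int (N 1)" "b = int (N (- 1))" "c = int (N \<i>)" "d = int (N (- \<i>))"
  have l_mu: "l i = s * \<mu> i" for i using s0 by (simp add: \<mu>_def)
  have "(\<Sum>i<p. \<mu> i) = of_int (a - b) + of_int (c - d) * \<i>"
    using sum_mu[of "\<lambda>v. v"] distinct by (simp add: abcd algebra_simps)
  then have g: "gauss_sum p 1 = s * (of_int (a - b) + of_int (c - d) * \<i>)"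
    unfolding mat_trace_dft[symmetric] l(1) l_mu sum_distrib_left[symmetric] by (simp only:)
  \<comment> \<open>The trace of \<open>dft * dft\<close> gives one linear relation between the
    multiplicities, the order of the matrix another.\<close>
  have "of_nat p = (s * s) * (\<Sum>i<p. (\<mu> i)\<^sup>2)"
    using l(2) by (simp add: mat_trace_dft_square l_mu sum_distrib_left power2_eq_square mult_ac)
  then have "(1::complex) = (\<Sum>i<p. (\<mu> i)\<^sup>2)" using p_gt_2 by (simp add: ss)
  also have "\<dots> = of_int (a + b - c - d)"
    using sum_mu[of "\<lambda>v. v\<^sup>2"] distinct by (simp add: abcd)
  finally have "of_int (a + b - c - d) = (of_int 1 :: complex)" by simp
  then have eq1: "a + b - c - d = 1" by (simp only: of_int_eq_iff)
  have "of_int (a + b + c + d) = (of_int (int p) :: complex)"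
    using sum_mu[of "\<lambda>_. 1"] distinct by (simp add: abcd)
  then have eq2: "a + b + c + d = int p" by (simp only: of_int_eq_iff)
  \<comment> \<open>\<open>gauss_sum_sq\<close> makes \<open>(a - b) + (c - d) * \<i>\<close> a
    square root of 1; comparing real and imaginary parts yields \<open>c = d\<close> and
    \<open>a - b = \<plusminus>1\<close>.\<close>
  have "of_nat p * (of_int (a - b) + of_int (c - d) * \<i>)\<^sup>2 = (of_nat p :: complex)"
    using gauss_sum_sq unfolding g ss[symmetric] by (simp add: power2_eq_square mult_ac)
  then have sq: "(of_int (a - b) + of_int (c - d) * \<i>)\<^sup>2 = (1 :: complex)" using p_gt_2 by simp
  have "Re ((of_int (a - b) + of_int (c - d) * \<i>)\<^sup>2) = of_int ((a - b)\<^sup>2 - (c - d)\<^sup>2)"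
    "Im ((of_int (a - b) + of_int (c - d) * \<i>)\<^sup>2) = of_int (2 * (a - b) * (c - d))"
    by (simp_all add: power2_eq_square)
  then have "of_int ((a - b)\<^sup>2 - (c - d)\<^sup>2) = (of_int 1 :: real)" "of_int (2 * (a - b) * (c - d)) = (of_int 0 :: real)"
    unfolding sq by simp_all
  then have re: "(a - b)\<^sup>2 - (c - d)\<^sup>2 = 1" and im: "2 * (a - b) * (c - d) = 0"
    unfolding of_int_eq_iff by blast+
  have "a - b \<noteq> 0"
  proof
    assume "a - b = 0"
    then have "(c - d)\<^sup>2 = - 1" using re by simp
    then show False using zero_le_power2[of "c - d"] by simp
  qed
  then have cd: "c = d" using im by simp
  then have ab: "a - b = 1 \<or> a - b = - 1" using re by (simp add: power2_eq_1_iff)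
  have "a - b = 1"
  proof (rule ccontr)
    assume "a - b \<noteq> 1"
    then have "b = a + 1" using ab by simp
    \<comment> \<open>The two linear relations give \<open>a + b = n + 1\<close>. As the equally
      many eigenvalues \<i> and -\<i> multiply to 1, the sign of the determinant is
      \<open>(- 1) ^ b\<close> with \<open>b = n div 2 + 1\<close>, contrary to
      \<open>det_dft\<close>.\<close>
    then have "2 * b = int n + 2" using eq1 eq2 cd int_p_eq by linarith
    then have Nb: "N (- 1) = n div 2 + 1" using even_n unfolding abcd by presburger
    have "N \<i> = N (- \<i>)" using cd by (simp add: abcd)
    then have "\<i> ^ N \<i> * (- \<i>) ^ N (- \<i>) = (\<i> * (- \<i>)) ^ N \<i>" by (simp only: power_mult_distrib)
    then have "(\<Prod>i<p. \<mu> i) = (- 1) ^ N (- 1)"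
      unfolding prod_mu using distinct by simp
    then have "det dft = s ^ p * (- 1) ^ (n div 2 + 1)"
      unfolding l(3) l_mu prod.distrib by (simp add: Nb)
    moreover obtain r where "r > 0" "det dft = (- 1) ^ (n div 2) * complex_of_real r"
      using det_dft by blast
    ultimately have "complex_of_real r = - complex_of_real (sqrt (real p) ^ p)"
      by (cases "even (n div 2)") (simp_all add: s_def, metis minus_minus)
    then have "r = - (sqrt (real p) ^ p)" by (metis of_real_eq_iff of_real_minus)
    then show False using \<open>r > 0\<close> p_gt_2 by simp
  qed
  then show ?thesis unfolding g using cd by (simp add: s_def)
qed

end

theorem theorem2:
  fixes p :: nat
  assumes "prime p" and "[p = 1] (mod 4)"
  shows "matC p = (gauss_sum p 2 * zeta p ^ ((p - 1) div 4))
                    \<cdot>\<^sub>m (matV p * matD p * matU p * matD p * matV p)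
       \<and> matC p = (legendre p 2 * of_real (sqrt (real p)) * zeta p ^ ((p - 1) div 4))
                    \<cdot>\<^sub>m (matV p * matD p * matU p * matD p * matV p)"
proof -
  interpret prime_1_mod_4 p "(p - 1) div 2"
    by unfold_locales fact+
  have "gauss_sum p 2 = legendre p 2 * of_real (sqrt (real p))"
    unfolding gauss_sum_mult[of 2] gauss_sum_eq_sqrt ..
  then show ?thesis using matC_factorization by simp
qed

end
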